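(* Let $P,Q$ be integers, and let $(v_n)$, $T$, $\mathcal P_{T,n}$, "special" and "basic" be as defined in the context. (a) For $n\in T$, the set $\mathcal P_{T,n}$ is the set of odd primes dividing $v_n$, with the possible inclusion of $2$. Specifically, the prime $2$ is in $\mathcal P_{T,n}$ if and only if $n$ is a product of special primes and either - $P$ is even; or - $Q$ is odd and $3\mid n$. (b) Every element of $T$ can be written in the form $bp_1\cdots p_r$ for some $r\ge0$, where $b\in T$ is (second kind) basic and, for $i=1,\dots,r$, the number $bp_1\cdots p_{i-1}$ is also in $T$, and $p_i$ is a prime in $\mathcal P_{T,bp_1\cdots p_{i-1}}$ (the primes $p_i$ need not be distinct). (c) The (second kind) basic elements of $T$ are - $1$ and $6$ if $P\equiv\pm1\pmod 6$ and $Q\equiv-1\pmod 6$; - $1$ only, otherwise.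
   Context: For integers $P,Q$, the Lucas sequence of the second kind $(v_n)_{n\ge0}$ is given by $v_0=2$, $v_1=P$, $v_{n+2}=Pv_{n+1}-Qv_n$ for $n\ge0$. Let $T=T(P,Q)$ be the set of all integers $n\ge1$ such that $n$ divides $v_n$ (every positive integer divides $0$). For $n\in T$, $\mathcal P_{T,n}$ is the set of primes $p$ such that $np\in T$. A prime is special if it divides both $P$ and $Q$. A product of special primes may have repeated factors, and may be empty (so $n=1$ counts as a product of special primes). An element $n\in T$ is called (second kind) basic if there is no prime $p$ such that $n/p$ is in $T$ (in particular $n/p$ would have to be an integer). *)

theory Defs
  imports "HOL-Number_Theory.Number_Theory"
begin

fun lucas_v :: "int \<Rightarrow> int \<Rightarrow> nat \<Rightarrow> int" where
  "lucas_v P Q 0 = 2"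
| "lucas_v P Q (Suc 0) = P"
| "lucas_v P Q (Suc (Suc n)) = P * lucas_v P Q (Suc n) - Q * lucas_v P Q n"

definition T_set :: "int \<Rightarrow> int \<Rightarrow> nat set" where
  "T_set P Q = {n. n \<ge> 1 \<and> int n dvd lucas_v P Q n}"

definition T_primes :: "int \<Rightarrow> int \<Rightarrow> nat \<Rightarrow> nat set" where
  "T_primes P Q n = {p. prime p \<and> n * p \<in> T_set P Q}"

definition special_prime :: "int \<Rightarrow> int \<Rightarrow> nat \<Rightarrow> bool" where
  "special_prime P Q p \<longleftrightarrow> prime p \<and> int p dvd P \<and> int p dvd Q"

definition product_of_special_primes :: "int \<Rightarrow> int \<Rightarrow> nat \<Rightarrow> bool" where
  "product_of_special_primes P Q n \<longleftrightarrow>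
     (\<exists>ps. (\<forall>p\<in>set ps. special_prime P Q p) \<and> n = prod_list ps)"

definition basic :: "int \<Rightarrow> int \<Rightarrow> nat \<Rightarrow> bool" where
  "basic P Q n \<longleftrightarrow>
     n \<in> T_set P Q \<and> \<not> (\<exists>p. prime p \<and> p dvd n \<and> n div p \<in> T_set P Q)"

end

theory Submission
  imports Defs
begin

text \<open>Since \<open>v\<^sub>n\<^sub>p(P, Q) = v\<^sub>p(v\<^sub>n, Q\<^sup>n)\<close>, for odd \<open>p = 2h + 1\<close> one has \<open>v\<^sub>n\<^sub>p = v\<^sub>n W\<close>
  with \<open>W \<equiv> p (-Q\<^sup>n)\<^sup>h\<close> modulo \<open>v\<^sub>n\<^sup>2\<close>, while \<open>v\<^sub>n\<^sub>p \<equiv> v\<^sub>n\<close> modulo \<open>p\<close>; this handles odd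
  primes in (a), and \<open>v\<^sub>2\<^sub>n = v\<^sub>n\<^sup>2 - 2 Q\<^sup>n\<close> handles the prime 2. For (c), write \<open>n = mp\<close> with \<open>p\<close>
  the largest prime factor of \<open>n\<close>, and let \<open>q\<^sup>k\<close> divide \<open>m\<close>. If \<open>q\<close> divides \<open>Q\<close>, it is special and
  \<open>q\<^sup>k\<close> divides \<open>v\<^sub>m\<close> outright. If not and \<open>q\<close> is odd, then the rank of \<open>q\<close> is not divisible by
  \<open>p > q\<close>, so \<open>q\<close> divides \<open>v\<^sub>m\<close> and the congruence for \<open>W\<close> yields \<open>q\<^sup>k\<close>. For \<open>q = 2\<close>
  and \<open>Q\<close> odd, \<open>n\<close> is not divisible by 4, and only the case of rank 3 and \<open>p = 3\<close> can fail; then \<open>n = 6\<close>.\<close>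

section \<open>Identities for the Lucas sequence\<close>

text \<open>With \<alpha>, \<beta> the roots of \<open>X^2 - P X + Q\<close>, expand
  \<open>(\<alpha>^n + \<beta>^n) (\<alpha>^(a+n) + \<beta>^(a+n))\<close> and use
  \<open>\<alpha> \<beta> = Q\<close>. The index \<open>a + 2 * n\<close> avoids subtraction; the
  induction varies \<open>a\<close>.\<close>

lemma lucas_v_add_double:
  "lucas_v P Q (a + 2 * n) = lucas_v P Q n * lucas_v P Q (a + n) - Q ^ n * lucas_v P Q a"
proof (induction n arbitrary: a rule: induct_nat_012)
  case (ge2 n)
  have A: "lucas_v P Q (Suc a + 2 * Suc n) =
      lucas_v P Q (Suc n) * lucas_v P Q (Suc a + Suc n) - Q ^ Suc n * lucas_v P Q (Suc a)"
    by (rule ge2.IH)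
  have B: "lucas_v P Q (Suc (Suc a) + 2 * n) =
      lucas_v P Q n * lucas_v P Q (Suc (Suc a) + n) - Q ^ n * lucas_v P Q (Suc (Suc a))"
    by (rule ge2.IH)
  have "lucas_v P Q (a + 2 * Suc (Suc n)) =
      P * lucas_v P Q (Suc a + 2 * Suc n) - Q * lucas_v P Q (Suc (Suc a) + 2 * n)"
    by simp
  also have "\<dots> = lucas_v P Q (Suc (Suc n)) * lucas_v P Q (a + Suc (Suc n))
      - Q ^ Suc (Suc n) * lucas_v P Q a"
    unfolding A B by (simp add: algebra_simps)
  finally show ?case .
qed simp_all

lemma lucas_v_double: "lucas_v P Q (2 * n) = (lucas_v P Q n)\<^sup>2 - 2 * Q ^ n"
  using lucas_v_add_double[of P Q 0 n] by (simp add: power2_eq_square)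

text \<open>The powers \<open>\<alpha>^n\<close> and \<open>\<beta>^n\<close> are the roots of
  \<open>X^2 - v_n X + Q^n\<close>. Statements about index \<open>n * p\<close> thus reduce to index
  \<open>p\<close> with other parameters.\<close>

lemma lucas_v_mult: "lucas_v P Q (n * m) = lucas_v (lucas_v P Q n) (Q ^ n) m"
proof (induction m rule: induct_nat_012)
  case (ge2 m)
  show ?case
    using lucas_v_add_double[of P Q "n * m" n] ge2.IH by (simp add: algebra_simps mult_2_right)
qed simp_all

lemma lucas_v_cong:
  assumes "[P = P'] (mod k)" "[Q = Q'] (mod k)"
  shows "[lucas_v P Q n = lucas_v P' Q' n] (mod k)"
  by (induction n rule: induct_nat_012) (use assms in \<open>auto intro!: cong_diff cong_mult\<close>)

lemma lucas_v_cong_power: "n \<ge> 1 \<Longrightarrow> [lucas_v P Q n = P ^ n] (mod Q)"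
proof (induction n rule: induct_nat_012)
  case (ge2 n)
  have "[P * lucas_v P Q (Suc n) - Q * lucas_v P Q n = P * P ^ Suc n - 0] (mod Q)"
    by (intro cong_diff cong_mult) (use ge2.IH in \<open>auto simp: cong_0_iff\<close>)
  then show ?case by simp
qed auto

text \<open>At an odd index the value is \<open>P\<close> times a polynomial in \<open>P^2\<close>
  and \<open>Q\<close>, whose constant term in \<open>P^2\<close> is singled out here.\<close>

lemma lucas_v_odd_index:
  "\<exists>W. lucas_v P Q (2 * h + 1) = P * W \<and> P\<^sup>2 dvd W - (2 * int h + 1) * (- Q) ^ h"
proof -
  \<comment> \<open>The recurrence mixes parities, so the even index is carried along in the
    induction.\<close>
  have "(\<exists>W. lucas_v P Q (2 * h + 1) = P * W \<and> P\<^sup>2 dvd W - (2 * int h + 1) * (- Q) ^ h)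
      \<and> P\<^sup>2 dvd lucas_v P Q (2 * h) - 2 * (- Q) ^ h"
  proof (induction h)
    case 0
    then show ?case by (auto intro: exI[of _ 1])
  next
    case (Suc h)
    then obtain W a b where W: "lucas_v P Q (2 * h + 1) = P * W"
      and a: "W = (2 * int h + 1) * (- Q) ^ h + P\<^sup>2 * a"
      and b: "lucas_v P Q (2 * h) = 2 * (- Q) ^ h + P\<^sup>2 * b"
      unfolding dvd_def by (metis add.commute diff_add_cancel)
    have even: "lucas_v P Q (2 * Suc h) = P * (P * W) - Q * lucas_v P Q (2 * h)"
      using W by simp
    have odd: "lucas_v P Q (2 * Suc h + 1) = P * (lucas_v P Q (2 * Suc h) - Q * W)"
      using W by (simp add: algebra_simps)
    have "lucas_v P Q (2 * Suc h) - 2 * (- Q) ^ Suc h = P\<^sup>2 * (W - Q * b)"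
      unfolding even b by (simp add: algebra_simps power2_eq_square)
    moreover from this have "lucas_v P Q (2 * Suc h) - Q * W - (2 * int (Suc h) + 1) * (- Q) ^ Suc h
        = P\<^sup>2 * (W - Q * b - Q * a)"
      by (simp add: a algebra_simps)
    ultimately show ?case using odd by (metis dvd_triv_left)
  qed
  then show ?thesis by blast
qed

section \<open>Congruences modulo an odd prime\<close>

lemma fermat_theorem_int:
  fixes a :: int
  assumes "prime p" "\<not> int p dvd a"
  shows "[a ^ (p - 1) = 1] (mod int p)"
proof -
  have "residues (int p)"
    using assms(1) prime_gt_1_nat by (auto simp: residues_def)
  moreover have "coprime a (int p)"
    using assms prime_imp_coprime[of "int p" a] by (simp add: coprime_commute)
  ultimately have "[a ^ totient p = 1] (mod int p)"
    using residues.euler_theorem[of "int p" a] by simp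
  then show ?thesis using assms(1) by (simp add: totient_prime)
qed

text \<open>In terms of the roots \<open>\<alpha>\<close>, \<open>\<beta>\<close> of \<open>X\<^sup>2 - P X + Q\<close> this is
  \<open>\<alpha>\<^sup>a \<beta>\<^sup>b + \<alpha>\<^sup>b \<beta>\<^sup>a\<close>.\<close>

definition root_sum :: "int \<Rightarrow> int \<Rightarrow> nat \<Rightarrow> nat \<Rightarrow> int" where
  "root_sum P Q a b = (if a \<le> b then Q ^ a * lucas_v P Q (b - a) else Q ^ b * lucas_v P Q (a - b))"

lemma root_sum_step: "root_sum P Q (Suc a) b + root_sum P Q a (Suc b) = P * root_sum P Q a b"
proof (cases a b rule: linorder_cases)
  case less
  then obtain d where "b = Suc (a + d)"
    using less_iff_Suc_add by auto
  then show ?thesis by (auto simp: root_sum_def Suc_diff_le algebra_simps)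
next
  case greater
  then obtain d where "a = Suc (b + d)"
    using less_iff_Suc_add by auto
  then show ?thesis by (cases d) (auto simp: root_sum_def Suc_diff_le algebra_simps)
qed (auto simp: root_sum_def)

text \<open>This is the binomial expansion of \<open>(\<alpha> + \<beta>)^n = P^n\<close>, added to
  itself with the roots exchanged.\<close>

lemma sum_choose_root_sum:
  "(\<Sum>k\<le>n. int (n choose k) * root_sum P Q (n - k) k) = 2 * P ^ n"
proof (induction n)
  case 0
  then show ?case by (simp add: root_sum_def)
next
  case (Suc n)
  let ?S = "root_sum P Q"
  have "(\<Sum>k\<le>Suc n. int (Suc n choose k) * ?S (Suc n - k) k)
      = (\<Sum>k\<le>n. int (n choose k) * ?S (n - k) (Suc k))
        + ((\<Sum>k\<le>n. int (n choose Suc k) * ?S (n - k) (Suc k)) + ?S (Suc n) 0)"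
    by (subst sum.atMost_Suc_shift) (simp add: algebra_simps sum.distrib)
  also have "(\<Sum>k\<le>n. int (n choose Suc k) * ?S (n - k) (Suc k)) + ?S (Suc n) 0
      = (\<Sum>k\<le>Suc n. int (n choose k) * ?S (Suc n - k) k)"
    by (subst sum.atMost_Suc_shift) simp
  also have "\<dots> = (\<Sum>k\<le>n. int (n choose k) * ?S (Suc (n - k)) k)"
    by (auto simp: Suc_diff_le intro!: sum.cong)
  finally have "(\<Sum>k\<le>Suc n. int (Suc n choose k) * ?S (Suc n - k) k)
      = (\<Sum>k\<le>n. int (n choose k) * (?S (Suc (n - k)) k + ?S (n - k) (Suc k)))"
    by (simp add: sum.distrib distrib_left)
  also have "\<dots> = P * (\<Sum>k\<le>n. int (n choose k) * ?S (n - k) k)"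
    unfolding root_sum_step by (simp add: sum_distrib_left mult_ac)
  finally show ?case using Suc.IH by simp
qed

text \<open>Modulo \<open>p\<close> only the two end terms of the binomial sum survive, and each
  equals \<open>v_p\<close>. Cancelling 2 leaves \<open>v_p \<equiv> P^p\<close>, and Fermat gives
  \<open>P\<close>.\<close>

lemma lucas_v_prime_cong:
  assumes "prime p" "odd p"
  shows "[lucas_v P Q p = P] (mod int p)"
proof -
  let ?f = "\<lambda>k. int (p choose k) * root_sum P Q (p - k) k"
  have p: "p > 0" using assms(1) prime_gt_0_nat by blast
  have "sum ?f {..p} = sum ?f {0, p} + sum ?f {0<..<p}"
  proof -
    have "{..p} = {0, p} \<union> {0<..<p}" using p by auto
    then show ?thesis by (simp only:) (subst sum.union_disjoint; simp)
  qed
  also have "sum ?f {0, p} = 2 * lucas_v P Q p"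
    using p by (simp add: root_sum_def)
  finally have "2 * P ^ p = 2 * lucas_v P Q p + sum ?f {0<..<p}"
    by (simp add: sum_choose_root_sum)
  moreover have "int p dvd sum ?f {0<..<p}"
    by (intro dvd_sum dvd_mult2) (use assms(1) in \<open>auto intro!: dvd_choose_prime\<close>)
  ultimately have "[2 * P ^ p = 2 * lucas_v P Q p] (mod int p)"
    by (simp add: cong_iff_dvd_diff)
  moreover have "coprime 2 (int p)"
    using assms(2) by simp
  ultimately have "[P ^ p = lucas_v P Q p] (mod int p)"
    using cong_mult_lcancel by blast
  moreover have "[P ^ p = P] (mod int p)"
  proof (cases "int p dvd P")
    case True
    then show ?thesis using p by (auto simp: cong_iff_dvd_diff intro!: dvd_diff dvd_trans[OF _ dvd_power])
  next
    case False
    then have "[P ^ (p - 1) = 1] (mod int p)"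
      by (rule fermat_theorem_int[OF assms(1)])
    then have "[P * P ^ (p - 1) = P * 1] (mod int p)"
      by (intro cong_mult) auto
    then show ?thesis using p by (simp flip: power_Suc)
  qed
  ultimately show ?thesis using cong_sym cong_trans by blast
qed

lemma lucas_v_mult_prime_cong:
  assumes "prime p" "odd p"
  shows "[lucas_v P Q (n * p) = lucas_v P Q n] (mod int p)"
  unfolding lucas_v_mult using assms by (rule lucas_v_prime_cong)

section \<open>Periodicity of the zeros modulo a prime\<close>

text \<open>The shifted sequence starts as \<open>c\<close> times
  \<open>(v_0, v_1) = (2, P)\<close>, and the recurrence propagates this.\<close>

lemma lucas_v_shift_cong:
  assumes "[lucas_v P Q s = 2 * c] (mod k)" "[lucas_v P Q (Suc s) = P * c] (mod k)"
  shows "[lucas_v P Q (a + s) = c * lucas_v P Q a] (mod k)"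
proof (induction a rule: induct_nat_012)
  case (ge2 a)
  have "[P * lucas_v P Q (Suc a + s) - Q * lucas_v P Q (a + s)
      = P * (c * lucas_v P Q (Suc a)) - Q * (c * lucas_v P Q a)] (mod k)"
    by (intro cong_diff cong_mult ge2.IH cong_refl)
  then show ?case by (simp add: algebra_simps)
qed (use assms in \<open>simp_all add: mult.commute\<close>)

text \<open>With \<open>x = v\<^sub>q\<^sub>-\<^sub>1\<close> and \<open>y = v\<^sub>q\<^sub>+\<^sub>1\<close> one has \<open>y + Q x \<equiv> P\<^sup>2\<close>
  and \<open>x y \<equiv> 2 v\<^sub>2\<close> modulo \<open>q\<close>, so that \<open>(x - 2) (y - 2 Q) \<equiv> 0\<close>.\<close>

lemma lucas_v_zeros_periodic:
  assumes "prime q" "odd q" "\<not> int q dvd Q"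
  obtains s where "s = q - 1 \<or> s = q + 1"
    "\<And>a. int q dvd lucas_v P Q (a + s) \<longleftrightarrow> int q dvd lucas_v P Q a"
proof -
  obtain r where q: "q = Suc r"
    using prime_gt_0_nat[OF assms(1)] gr0_conv_Suc by blast
  define x where "x = lucas_v P Q r"
  have vq: "[lucas_v P Q (Suc r) = P] (mod int q)"
    using lucas_v_prime_cong[OF assms(1,2)] q by simp
  have "[lucas_v P Q (2 * q) = lucas_v P Q 2] (mod int q)"
    by (rule lucas_v_mult_prime_cong[OF assms(1,2)])
  moreover have "lucas_v P Q (2 * q) = x * lucas_v P Q (Suc (Suc r)) - Q ^ r * lucas_v P Q 2"
    using lucas_v_add_double[of P Q 2 r] by (simp add: q x_def numeral_2_eq_2)
  moreover have "lucas_v P Q 2 = P\<^sup>2 - 2 * Q"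
    by (simp add: numeral_2_eq_2 algebra_simps)
  ultimately have "[x * lucas_v P Q (Suc (Suc r)) - Q ^ r * (P\<^sup>2 - 2 * Q) = P\<^sup>2 - 2 * Q] (mod int q)"
    by simp
  moreover have "[Q ^ r = 1] (mod int q)"
    using fermat_theorem_int[OF assms(1,3)] q by simp
  moreover have vq1: "[lucas_v P Q (Suc (Suc r)) = P * P - Q * x] (mod int q)"
    using vq by (auto simp: x_def intro!: cong_diff cong_mult)
  ultimately have "[x * (P * P - Q * x) - 1 * (P\<^sup>2 - 2 * Q) = P\<^sup>2 - 2 * Q] (mod int q)"
    by (meson cong_diff cong_mult cong_refl cong_sym cong_trans)
  then have "int q dvd x * (P * P - Q * x) - 1 * (P\<^sup>2 - 2 * Q) - (P\<^sup>2 - 2 * Q)"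
    by (simp add: cong_iff_dvd_diff)
  also have "\<dots> = (x - 2) * (P * P - Q * x - 2 * Q)"
    by (simp add: algebra_simps power2_eq_square)
  \<comment> \<open>These cases replace the question whether \<alpha> and \<beta> lie in the field
    with \<open>q\<close> elements: the first gives the shift \<open>q - 1\<close> with factor 1,
    the second \<open>q + 1\<close> with factor \<open>Q\<close>.\<close>
  finally consider "int q dvd x - 2" | "int q dvd P * P - Q * x - 2 * Q"
    using assms(1) by (auto dest: prime_dvd_multD[rotated])
  then show thesis
  proof cases
    case 1
    then have "[lucas_v P Q r = 2 * 1] (mod int q)"
      by (simp add: x_def cong_iff_dvd_diff)
    then have "[lucas_v P Q (a + r) = 1 * lucas_v P Q a] (mod int q)" for a
      by (rule lucas_v_shift_cong) (use vq in simp)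
    then show thesis
      by (intro that[of r]) (auto simp: q dest: cong_dvd_iff)
  next
    case 2
    then have "[P * P - Q * x = 2 * Q] (mod int q)"
      by (simp add: cong_iff_dvd_diff)
    with vq1 have v: "[lucas_v P Q (Suc (Suc r)) = 2 * Q] (mod int q)"
      by (rule cong_trans)
    have "[P * lucas_v P Q (Suc (Suc r)) - Q * lucas_v P Q (Suc r) = P * (2 * Q) - Q * P] (mod int q)"
      by (intro cong_diff cong_mult v vq cong_refl)
    then have "[lucas_v P Q (Suc (Suc (Suc r))) = P * Q] (mod int q)"
      by (simp add: algebra_simps)
    with v have shift: "[lucas_v P Q (a + Suc (Suc r)) = Q * lucas_v P Q a] (mod int q)" for a
      by (rule lucas_v_shift_cong)
    have "int q dvd lucas_v P Q (a + Suc (Suc r)) \<longleftrightarrow> int q dvd lucas_v P Q a" for a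
      using cong_dvd_iff[OF shift] assms by (simp add: prime_dvd_mult_iff)
    then show thesis
      by (intro that[of "Suc (Suc r)"]) (auto simp: q)
  qed
qed

lemma periodic_nat_cong:
  fixes s :: nat
  assumes "\<And>a. Z (a + s) \<longleftrightarrow> Z a" "[a = b] (mod s)"
  shows "Z a \<longleftrightarrow> Z b"
proof -
  have *: "Z (a + s * t) \<longleftrightarrow> Z a" for a t
  proof (induction t)
    case (Suc t)
    have "Z (a + s * Suc t) \<longleftrightarrow> Z (a + s * t + s)" by (simp add: add_ac)
    then show ?case using Suc.IH assms(1) by simp
  qed simp
  have "Z a \<longleftrightarrow> Z (a mod s)" for a
    using *[of "a mod s" "a div s"] by simp
  then show ?thesis using assms(2) by (metis cong_def)
qed

text \<open>The zeros of \<open>v\<close> modulo \<open>q\<close> are invariant under the shift by \<open>2mp\<close> and under the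
  shift by one of \<open>q \<plusminus> 1\<close>, and \<open>p\<close> does not divide \<open>q \<plusminus> 1\<close>; hence they are also invariant under a shift from \<open>m\<close> to \<open>mp\<close>.\<close>

lemma lucas_v_zero_div_prime:
  assumes "prime q" "odd q" "\<not> int q dvd Q" "prime p" "q < p"
    and dvd: "int q dvd lucas_v P Q (m * p)"
  shows "int q dvd lucas_v P Q m"
proof -
  let ?Z = "\<lambda>a. int q dvd lucas_v P Q a"
  obtain s where s: "s = q - 1 \<or> s = q + 1" and period: "\<And>a. ?Z (a + s) \<longleftrightarrow> ?Z a"
    using lucas_v_zeros_periodic[OF assms(1-3)] by metis
  have q3: "q \<ge> 3"
    using assms(1,2) prime_ge_2_nat[of q] by (cases "q = 2") auto
  then have "odd p"
    using assms(4,5) by (intro prime_odd_nat) auto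
  then obtain h where h: "p = 2 * h + 1" by (elim oddE)
  \<comment> \<open>Both \<open>p\<close> and \<open>q\<close> are odd, so \<open>p > q\<close> even
    forces \<open>p > q + 1\<close>.\<close>
  have "s < p" "s > 0"
    using s assms(2,5) \<open>odd p\<close> q3 by (auto intro: le_neq_implies_less)
  then have "coprime p s"
    using assms(4) by (auto intro!: prime_imp_coprime dest: dvd_imp_le)
  then obtain x where x: "[p * x = 1] (mod s)"
    using cong_solve_coprime_nat by auto
  \<comment> \<open>As \<open>q\<close> divides \<open>v_(mp)\<close>, the addition formula leaves
    \<open>- Q^(mp) v_a\<close> modulo \<open>q\<close>.\<close>
  have shift: "?Z (a + 2 * (m * p)) \<longleftrightarrow> ?Z a" for a
  proof -
    have "coprime (int q) (Q ^ (m * p))"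
      using assms(1,3) by (auto intro!: prime_imp_coprime dest: prime_dvd_power)
    then show ?thesis
      unfolding lucas_v_add_double using dvd
      by (simp add: dvd_diff_right_iff coprime_dvd_mult_right_iff)
  qed
  \<comment> \<open>This index links \<open>m\<close> and \<open>m * p\<close>: modulo
    \<open>s\<close> the factor \<open>p * x\<close> is 1, and
    \<open>m + 2 * m * h = m * p\<close>.\<close>
  have "[m + 2 * (m * p) * (h * x) = m] (mod 2 * (m * p))"
    by (simp add: cong_def)
  then have "?Z (m + 2 * (m * p) * (h * x)) \<longleftrightarrow> ?Z m"
    by (rule periodic_nat_cong[where Z = ?Z, OF shift])
  moreover have "[m + (2 * m * h) * (p * x) = m + (2 * m * h) * 1] (mod s)"
    by (intro cong_add cong_mult x cong_refl)
  then have "[m + 2 * (m * p) * (h * x) = m * p] (mod s)"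
    by (simp add: h algebra_simps mult_2_right)
  then have "?Z (m + 2 * (m * p) * (h * x)) \<longleftrightarrow> ?Z (m * p)"
    by (rule periodic_nat_cong[where Z = ?Z, OF period])
  ultimately show ?thesis using dvd by simp
qed

section \<open>Special primes and divisibility by prime powers\<close>

text \<open>Both terms of the recurrence gain a factor \<open>r\<close>; the term with
  \<open>v_n\<close> has the weaker bound, so the exponent grows by one every two indices.\<close>

lemma common_divisor_power_dvd_lucas_v:
  assumes "r dvd P" "r dvd Q"
  shows "r ^ ((n + 1) div 2) dvd lucas_v P Q n"
proof (induction n rule: induct_nat_012)
  case (ge2 n)
  have "r ^ ((n + 3) div 2) dvd r * r ^ ((Suc n + 1) div 2)"
    by (subst power_Suc[symmetric]) (intro le_imp_power_dvd, simp)
  moreover have "r * r ^ ((Suc n + 1) div 2) dvd P * lucas_v P Q (Suc n)"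
    using assms(1) ge2.IH(2) by (rule mult_dvd_mono)
  moreover have "r * r ^ ((n + 1) div 2) dvd Q * lucas_v P Q n"
    using assms(2) ge2.IH(1) by (rule mult_dvd_mono)
  moreover have "r * r ^ ((n + 1) div 2) = r ^ ((n + 3) div 2)"
    by (subst power_Suc[symmetric]) (rule arg_cong[where f = "power r"], simp)
  ultimately have "r ^ ((n + 3) div 2) dvd P * lucas_v P Q (Suc n) - Q * lucas_v P Q n"
    by (metis dvd_diff dvd_trans)
  then show ?case by (simp add: numeral_3_eq_3)
qed (use assms in auto)

text \<open>A size comparison suffices: \<open>2 k \<le> 2^k \<le> q^k \<le> m\<close> for
  \<open>k > 0\<close>, so the exponent \<open>(m + 1) div 2\<close> is at least
  \<open>k\<close>.\<close>

lemma special_prime_power_dvd_lucas_v: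
  assumes "prime q" "int q dvd P" "int q dvd Q" "q ^ k dvd m" "m > 0"
  shows "int q ^ k dvd lucas_v P Q m"
proof -
  have "2 * k \<le> 2 ^ k" if "k > 0"
  proof -
    from that obtain j where "k = Suc j" using gr0_conv_Suc by blast
    moreover have "Suc j \<le> 2 ^ j" by (rule Suc_leI) (rule less_exp)
    ultimately show ?thesis by simp
  qed
  moreover have "(2::nat) ^ k \<le> q ^ k"
    using prime_ge_2_nat[OF assms(1)] by (rule power_mono) simp
  moreover have "q ^ k \<le> m"
    using assms(4,5) by (rule dvd_imp_le)
  ultimately have "2 * k \<le> m"
    by (cases "k = 0") (simp, linarith)
  then have "k \<le> (m + 1) div 2"
    by linarith
  then show ?thesis
    using common_divisor_power_dvd_lucas_v[OF assms(2,3)] by (rule power_le_dvd[rotated])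
qed

lemma int_dvd_by_prime_powers:
  fixes x :: int
  assumes "n > 0" "\<And>p k. prime p \<Longrightarrow> k > 0 \<Longrightarrow> p ^ k dvd n \<Longrightarrow> int p ^ k dvd x"
  shows "int n dvd x"
proof (cases "x = 0")
  case False
  have "n dvd nat \<bar>x\<bar>"
  proof (rule multiplicity_le_imp_dvd)
    fix p :: nat assume p: "prime p"
    have "int p ^ multiplicity p n dvd x"
      using assms(2)[OF p, of "multiplicity p n"] multiplicity_dvd
      by (cases "multiplicity p n = 0") auto
    then have "p ^ multiplicity p n dvd nat \<bar>x\<bar>"
      by (simp add: nat_dvd_iff flip: of_nat_power)
    then show "multiplicity p n \<le> multiplicity p (nat \<bar>x\<bar>)"
      using False p by (intro multiplicity_geI) auto
  qed (use assms(1) in simp)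
  then show ?thesis by simp
qed simp

text \<open>Modulo \<open>q\<close> the value \<open>v_n\<close> is \<open>P^n\<close>, and
  \<open>q\<close> divides it through \<open>n\<close>. Hence a prime factor of \<open>n\<close>
  that divides \<open>Q\<close> is special.\<close>

lemma T_set_prime_dvd_P:
  assumes "n \<in> T_set P Q" "prime q" "q dvd n" "int q dvd Q"
  shows "int q dvd P"
proof -
  have n: "n \<ge> 1" "int n dvd lucas_v P Q n"
    using assms(1) by (auto simp: T_set_def)
  have "[lucas_v P Q n = P ^ n] (mod int q)"
    using lucas_v_cong_power[OF n(1)] assms(4) by (rule cong_dvd_modulus)
  moreover have "int q dvd lucas_v P Q n"
    using assms(3) n(2) by (meson dvd_trans of_nat_dvd_iff)
  ultimately have "int q dvd P ^ n"
    by (simp add: cong_dvd_iff)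
  then show ?thesis using assms(2) by (auto dest: prime_dvd_power[rotated])
qed

section \<open>Parity and divisibility by 4\<close>

text \<open>Modulo 2 the sequence repeats 0, 1, 1.\<close>

lemma even_lucas_v_iff:
  assumes "odd P" "odd Q"
  shows "even (lucas_v P Q n) \<longleftrightarrow> 3 dvd n"
proof -
  let ?Z = "\<lambda>a. even (lucas_v P Q a)"
  have period: "?Z (a + 3) \<longleftrightarrow> ?Z a" for a
    using assms by (auto simp: numeral_3_eq_3)
  have "?Z n \<longleftrightarrow> ?Z (n mod 3)"
    by (rule periodic_nat_cong[where Z = ?Z and s = 3, OF period]) (simp add: cong_def)
  also have "\<dots> \<longleftrightarrow> n mod 3 = 0"
  proof -
    consider "n mod 3 = 0" | "n mod 3 = 1" | "n mod 3 = 2" by linarith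
    then show ?thesis using assms by cases (auto simp: numeral_2_eq_2)
  qed
  finally show ?thesis by (simp add: dvd_eq_mod_eq_0)
qed

lemma odd_lucas_v:
  assumes "odd P" "even Q" "n \<ge> 1"
  shows "odd (lucas_v P Q n)"
proof -
  have "[lucas_v P Q n = P ^ n] (mod 2)"
    using lucas_v_cong_power[OF assms(3)] assms(2) by (rule cong_dvd_modulus)
  then show ?thesis using assms(1) by (metis cong_dvd_iff even_power)
qed

lemma even_lucas_v:
  assumes "even P"
  shows "even (lucas_v P Q n)"
  by (induction n rule: induct_nat_012) (use assms in auto)

text \<open>If \<open>v_(2k) = v_k^2 - 2 Q^k\<close> is even, then so is \<open>v_k\<close>, and the
  value is 2 modulo 4.\<close>

lemma even_lucas_v_imp_not_4_dvd:
  assumes "odd Q" "even (lucas_v P Q (2 * k))"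
  shows "\<not> 4 dvd lucas_v P Q (2 * k)"
proof
  assume 4: "4 dvd lucas_v P Q (2 * k)"
  have "even (lucas_v P Q k)"
    using assms(2) by (simp add: lucas_v_double)
  then have "4 dvd (lucas_v P Q k)\<^sup>2"
    by (auto simp: power2_eq_square elim!: evenE)
  with 4 have "2 * 2 dvd 2 * Q ^ k"
    unfolding lucas_v_double by (simp add: dvd_diff_right_iff)
  then have "even (Q ^ k)"
    by (subst (asm) dvd_times_left_cancel_iff) auto
  then show False using assms(1) by simp
qed

lemma T_set_not_4_dvd:
  assumes "n \<in> T_set P Q" "odd Q"
  shows "\<not> 4 dvd n"
proof
  assume 4: "4 dvd n"
  then have "even n" by auto
  then obtain k where k: "n = 2 * k" by (elim evenE)
  have "int 4 dvd int n"
    using 4 by (simp only: of_nat_dvd_iff)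
  moreover have "int n dvd lucas_v P Q n"
    using assms(1) by (simp add: T_set_def)
  ultimately have v4: "4 dvd lucas_v P Q n"
    using dvd_trans by fastforce
  moreover have "2 dvd (4::int)" by simp
  ultimately have "even (lucas_v P Q n)" by (rule dvd_trans[rotated])
  with v4 show False
    using even_lucas_v_imp_not_4_dvd[OF assms(2)] unfolding k by blast
qed

section \<open>Adjoining a prime to an element of T\<close>

text \<open>One direction is \<open>v_(np) \<equiv> v_n\<close> modulo \<open>p\<close>. For the
  other, \<open>v_(np) = v_n W\<close> with \<open>n\<close> dividing \<open>v_n\<close> and
  \<open>p\<close> dividing \<open>W\<close>; this allows \<open>p\<close> to divide
  \<open>n\<close>.\<close>

lemma T_set_odd_prime_mult:
  assumes "n \<in> T_set P Q" "prime p" "odd p"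
  shows "n * p \<in> T_set P Q \<longleftrightarrow> int p dvd lucas_v P Q n"
proof
  assume "n * p \<in> T_set P Q"
  then have "int p dvd lucas_v P Q (n * p)"
    by (auto simp: T_set_def elim: dvd_mult_right)
  then show "int p dvd lucas_v P Q n"
    using cong_dvd_iff[OF lucas_v_mult_prime_cong[OF assms(2,3)]] by simp
next
  assume p: "int p dvd lucas_v P Q n"
  obtain h where h: "p = 2 * h + 1" using assms(3) by (elim oddE)
  obtain W where W: "lucas_v P Q (n * p) = lucas_v P Q n * W"
    and "(lucas_v P Q n)\<^sup>2 dvd W - (2 * int h + 1) * (- (Q ^ n)) ^ h"
    using lucas_v_odd_index[of "lucas_v P Q n" "Q ^ n" h] unfolding lucas_v_mult h by blast
  then have "(lucas_v P Q n)\<^sup>2 dvd W - int p * (- (Q ^ n)) ^ h"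
    by (simp add: h add.commute)
  moreover have "int p dvd (lucas_v P Q n)\<^sup>2"
    using p by (simp add: power2_eq_square)
  ultimately have "int p dvd W - int p * (- (Q ^ n)) ^ h"
    using dvd_trans by blast
  then have "int p dvd W"
    by (simp add: dvd_diff_left_iff)
  then have "int n * int p dvd lucas_v P Q n * W"
    using assms(1) by (intro mult_dvd_mono) (auto simp: T_set_def)
  then show "n * p \<in> T_set P Q"
    using assms(1) prime_gt_0_nat[OF assms(2)] by (auto simp: T_set_def W)
qed

lemma product_of_special_primes_iff:
  assumes "n > 0"
  shows "product_of_special_primes P Q n \<longleftrightarrow> (\<forall>p. prime p \<longrightarrow> p dvd n \<longrightarrow> special_prime P Q p)"
proof
  assume "product_of_special_primes P Q n"
  then obtain ps where ps: "\<forall>p\<in>set ps. special_prime P Q p" and n: "n = prod_list ps"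
    by (auto simp: product_of_special_primes_def)
  show "\<forall>p. prime p \<longrightarrow> p dvd n \<longrightarrow> special_prime P Q p"
  proof (intro allI impI)
    fix p assume p: "prime p" "p dvd n"
    then have "p dvd prod_mset (mset ps)" by (simp add: n prod_mset_prod_list)
    then obtain r where "r \<in> set ps" "p dvd r"
      using p(1) by (auto simp: prime_dvd_prod_mset_iff)
    moreover from this have "p = r"
      using ps p(1) by (auto simp: special_prime_def dest: primes_dvd_imp_eq)
    ultimately show "special_prime P Q p" using ps by simp
  qed
next
  assume *: "\<forall>p. prime p \<longrightarrow> p dvd n \<longrightarrow> special_prime P Q p"
  obtain ps where ps: "mset ps = prime_factorization n"
    using ex_mset by blast
  then have "set ps = prime_factors n"
    by (metis set_mset_mset)
  then have "\<forall>p\<in>set ps. special_prime P Q p"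
    using * by auto
  moreover have "n = prod_list ps"
    using assms ps by (metis prod_mset_prod_list prod_mset_prime_factorization_nat)
  ultimately show "product_of_special_primes P Q n"
    by (auto simp: product_of_special_primes_def)
qed

text \<open>By \<open>v_(2n) = v_n^2 - 2 Q^n\<close>, the condition amounts to \<open>v_n\<close>
  being even and \<open>n\<close> dividing \<open>Q^n\<close>. The latter says that all prime
  factors of \<open>n\<close> divide \<open>Q\<close>, hence are special.\<close>

lemma T_set_double:
  assumes n: "n \<in> T_set P Q"
  shows "n * 2 \<in> T_set P Q \<longleftrightarrow>
    product_of_special_primes P Q n \<and> (even P \<or> odd Q \<and> 3 dvd n)"
proof
  have n1: "n \<ge> 1" and nv: "int n dvd lucas_v P Q n"
    using n by (auto simp: T_set_def)
  {
    assume n2: "n * 2 \<in> T_set P Q"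
    have v2: "int n * 2 dvd (lucas_v P Q n)\<^sup>2 - 2 * Q ^ n"
      using n2 lucas_v_double[of P Q n] by (simp add: T_set_def mult.commute)
    have "even (lucas_v P Q n)"
      using dvd_mult_right[OF v2] by simp
    then have "even P \<or> odd Q \<and> 3 dvd n"
      using even_lucas_v_iff[of P Q n] odd_lucas_v[of P Q n] n1 by auto
    moreover have "special_prime P Q p" if p: "prime p" "p dvd n" for p
    proof -
      have pn: "int p dvd int n" using p(2) by simp
      have "int p dvd Q"
      proof (cases "p = 2")
        \<comment> \<open>The factor 2 in \<open>2 * Q ^ n\<close> would absorb \<open>p\<close>, so
          the exclusion of multiples of 4 is used instead.\<close>
        case True
        then have "4 dvd n * 2" using p(2) by auto
        then have "even Q" using T_set_not_4_dvd[OF n2] by auto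
        then show ?thesis using True by simp
      next
        case False
        have "int p dvd (lucas_v P Q n)\<^sup>2"
          using pn nv by (auto simp: power2_eq_square intro: dvd_trans dvd_mult2)
        moreover have "int p dvd (lucas_v P Q n)\<^sup>2 - 2 * Q ^ n"
          using pn dvd_mult_left[OF v2] by (rule dvd_trans)
        ultimately have "int p dvd 2 * Q ^ n"
          by (simp add: dvd_diff_right_iff)
        moreover have "\<not> int p dvd 2"
          using False p(1) by (metis of_nat_dvd_iff of_nat_numeral primes_dvd_imp_eq two_is_prime_nat)
        ultimately show ?thesis
          using p(1) by (auto simp: prime_dvd_mult_iff dest: prime_dvd_power[rotated])
      qed
      then show ?thesis
        using T_set_prime_dvd_P[OF n p] p(1) by (simp add: special_prime_def)
    qed
    ultimately show "product_of_special_primes P Q n \<and> (even P \<or> odd Q \<and> 3 dvd n)"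
      using n1 by (simp add: product_of_special_primes_iff)
  }
  assume *: "product_of_special_primes P Q n \<and> (even P \<or> odd Q \<and> 3 dvd n)"
  then have sp: "special_prime P Q p" if "prime p" "p dvd n" for p
    using that n1 by (simp add: product_of_special_primes_iff)
  have "int n dvd Q ^ n"
  proof (rule int_dvd_by_prime_powers)
    fix p k :: nat assume pk: "prime p" "k > 0" "p ^ k dvd n"
    then have "p dvd n"
      by (meson dvd_power dvd_trans)
    then have "int p dvd Q"
      using sp pk(1) by (simp add: special_prime_def)
    \<comment> \<open>This follows from \<open>k < 2^k \<le> p^k \<le> n\<close>.\<close>
    moreover have "k \<le> n"
      using less_exp[of k] power_mono[OF prime_ge_2_nat[OF pk(1)], of k] dvd_imp_le[OF pk(3)] n1
      by linarith
    ultimately show "int p ^ k dvd Q ^ n"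
      by (rule dvd_power_le)
  qed (use n1 in simp)
  then have "int n * 2 dvd 2 * Q ^ n"
    by (simp add: mult.commute)
  moreover have "even (lucas_v P Q n)"
    using * even_lucas_v even_lucas_v_iff by blast
  then have "int n * 2 dvd (lucas_v P Q n)\<^sup>2"
    unfolding power2_eq_square using nv by (rule mult_dvd_mono[rotated])
  ultimately have "int n * 2 dvd lucas_v P Q (2 * n)"
    unfolding lucas_v_double by (rule dvd_diff[rotated])
  then show "n * 2 \<in> T_set P Q"
    using n1 by (simp add: T_set_def mult.commute)
qed

section \<open>Removing the largest prime, and the basic elements\<close>

text \<open>Each prime power in \<open>m\<close> is traced from \<open>v_(mp) = v_m W\<close> back
  to \<open>v_m\<close>. The parity hypothesis serves \<open>q = 2\<close> with \<open>Q\<close>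
  odd, where the descent of zeros for odd primes does not apply. The prime \<open>p\<close> may
  still divide \<open>m\<close>.\<close>

lemma T_set_div_largest_prime:
  assumes mp: "m * p \<in> T_set P Q" and p: "prime p" "odd p"
    and largest: "\<And>q. prime q \<Longrightarrow> q dvd m \<Longrightarrow> q \<le> p"
    and parity: "even m \<Longrightarrow> even (lucas_v P Q m)"
  shows "m \<in> T_set P Q"
proof -
  have m: "m > 0" and dvd_v: "int (m * p) dvd lucas_v P Q (m * p)"
    using mp by (auto simp: T_set_def)
  obtain h where h: "p = 2 * h + 1" using p(2) by (elim oddE)
  obtain W where W: "lucas_v P Q (m * p) = lucas_v P Q m * W"
    and W_cong: "(lucas_v P Q m)\<^sup>2 dvd W - (2 * int h + 1) * (- (Q ^ m)) ^ h"
    using lucas_v_odd_index[of "lucas_v P Q m" "Q ^ m" h] unfolding lucas_v_mult h by blast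
  have "int m dvd lucas_v P Q m"
  proof (rule int_dvd_by_prime_powers)
    fix q k :: nat assume q: "prime q" "k > 0" "q ^ k dvd m"
    have qm: "q dvd m" using q(2,3) by (meson dvd_power dvd_trans)
    then have q_mp: "q dvd m * p" by simp
    then have q_v: "int q dvd lucas_v P Q (m * p)"
      using dvd_v by (meson dvd_trans of_nat_dvd_iff)
    consider "int q dvd Q" | "q = 2" "\<not> int q dvd Q" | "odd q" "\<not> int q dvd Q"
      using q(1) prime_prime_factor by (metis primes_dvd_imp_eq two_is_prime_nat)
    then show "int q ^ k dvd lucas_v P Q m"
    proof cases
      case 1
      then have "int q dvd P" using T_set_prime_dvd_P[OF mp q(1) q_mp] by simp
      then show ?thesis using special_prime_power_dvd_lucas_v[OF q(1) _ 1 q(3) m] by simp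
    next
      case 2
      \<comment> \<open>Only the exponent 1 is possible here, so parity of \<open>v_m\<close> is
        enough.\<close>
      then have "\<not> 4 dvd m * p" using T_set_not_4_dvd[OF mp] by simp
      then have "\<not> 2 ^ 2 dvd m" by auto
      then have "\<not> 2 \<le> k" using q(3) 2(1) by (meson power_le_dvd)
      then have "k = 1" using q(2) by simp
      then show ?thesis using parity qm 2(1) by simp
    next
      case 3
      have q_vm: "int q dvd lucas_v P Q m"
      proof (cases "q = p")
        case True
        then show ?thesis
          using q_v cong_dvd_iff[OF lucas_v_mult_prime_cong[OF p]] by simp
      next
        case False
        then have "q < p" using largest[OF q(1) qm] by simp
        then show ?thesis
          using lucas_v_zero_div_prime[OF q(1) 3 p(1) _ q_v] by simp
      qed
      have q_Q: "\<not> int q dvd (- (Q ^ m)) ^ h"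
        using q(1) 3(2) by (auto dest!: prime_dvd_power[rotated])
      have q_W: "(int q)\<^sup>2 dvd W - int p * (- (Q ^ m)) ^ h"
      proof (rule dvd_trans)
        show "(int q)\<^sup>2 dvd (lucas_v P Q m)\<^sup>2" using q_vm by (rule dvd_power_same)
        show "(lucas_v P Q m)\<^sup>2 dvd W - int p * (- (Q ^ m)) ^ h"
          using W_cong by (simp add: h add.commute)
      qed
      show ?thesis
      proof (cases "q = p")
        case True
        \<comment> \<open>Here \<open>W\<close> absorbs at most one factor \<open>p\<close>, which
          is offset by the extra \<open>p\<close> in \<open>m * p\<close>.\<close>
        have "\<not> (int q)\<^sup>2 dvd W"
        proof
          assume "(int q)\<^sup>2 dvd W"
          with q_W have "int q * int q dvd int q * (- (Q ^ m)) ^ h"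
            by (simp add: True dvd_diff_right_iff power2_eq_square)
          then show False using q_Q q(1) by (simp add: prime_gt_0_nat)
        qed
        moreover have "int q ^ Suc k dvd lucas_v P Q m * W"
        proof -
          have "q ^ Suc k dvd m * p" using q(3) True by (simp add: mult.commute)
          then show ?thesis using dvd_v W by (metis dvd_trans of_nat_dvd_iff of_nat_power)
        qed
        ultimately show ?thesis
          using prime_elem_power_dvd_cases[of "int q" "Suc k" "lucas_v P Q m" W k 2] q(1) by auto
      next
        case False
        \<comment> \<open>Now \<open>W\<close> is prime to \<open>q\<close>, so the whole power
          \<open>q^k\<close> falls on \<open>v_m\<close>.\<close>
        have "\<not> int q dvd W"
        proof
          assume "int q dvd W"
          moreover have "int q dvd W - int p * (- (Q ^ m)) ^ h"
            using q_W by (auto simp: power2_eq_square dest: dvd_mult_left)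
          ultimately have "int q dvd int p * (- (Q ^ m)) ^ h"
            by (simp add: dvd_diff_right_iff)
          then have "q dvd p" using q(1) q_Q by (simp add: prime_dvd_mult_iff)
          then show False using False p(1) q(1) by (simp add: primes_dvd_imp_eq)
        qed
        moreover have "int q ^ k dvd lucas_v P Q m * W"
          using q(3) dvd_v W by (metis dvd_mult2 dvd_trans of_nat_dvd_iff of_nat_power)
        ultimately show ?thesis
          using prime_elem_power_dvd_cases[of "int q" k "lucas_v P Q m" W k 1] q(1) by auto
      qed
    qed
  qed (use m in simp)
  then show ?thesis using m by (simp add: T_set_def)
qed

lemma basic_eq_1_or_6:
  assumes "basic P Q n"
  shows "n = 1 \<or> n = 6"
proof (rule ccontr)
  assume not: "\<not> (n = 1 \<or> n = 6)"
  have n: "n \<in> T_set P Q"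
    using assms by (simp add: basic_def)
  have basic: "m \<notin> T_set P Q" if "prime p" "n = m * p" for p m
  proof -
    have "n div p = m" "p dvd n" using that prime_gt_0_nat[of p] by auto
    then show ?thesis using assms that(1) by (auto simp: basic_def)
  qed
  have n1: "n > 1" using n not by (auto simp: T_set_def)
  let ?p = "Max (prime_factors n)"
  have "prime_factors n \<noteq> {}"
    using n1 prime_factor_nat[of n] by (auto simp: prime_factors_dvd)
  then have "?p \<in> prime_factors n" by (intro Max_in) auto
  then obtain p where p: "prime p" "p dvd n" "p = ?p" by auto
  have largest: "q \<le> p" if "prime q" "q dvd n" for q
    using that n1 by (auto simp: p(3) prime_factors_dvd intro!: Max_ge)
  obtain m where m: "n = m * p" using that[of "n div p"] p(2) by simp
  have m0: "m > 0" using n1 m by (cases m) auto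
  show False
  proof (cases "p = 2")
    case True
    \<comment> \<open>With 2 as the largest prime factor, \<open>n\<close> is a power of 2.\<close>
    have two: "q = 2" if "prime q" "q dvd m" for q
      using largest[of q] that prime_ge_2_nat[of q] True m by auto
    have "int m dvd lucas_v P Q m"
    proof (cases "even Q")
      case even: True
      then have "even P" using T_set_prime_dvd_P[OF n p(1,2)] True by simp
      show ?thesis
      proof (rule int_dvd_by_prime_powers)
        fix q k :: nat assume q: "prime q" "k > 0" "q ^ k dvd m"
        then have "q = 2" using two by (meson dvd_power dvd_trans)
        then show "int q ^ k dvd lucas_v P Q m"
          using special_prime_power_dvd_lucas_v[OF q(1) _ _ q(3) m0] even \<open>even P\<close> by simp
      qed (rule m0)
    next
      case False
      then have "odd m" using T_set_not_4_dvd[OF n] m True by auto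
      then have "m = 1" using two prime_factor_nat[of m] by auto
      then show ?thesis by simp
    qed
    then show False using basic[OF p(1) m] m0 by (simp add: T_set_def)
  next
    case False
    then have odd: "odd p" using p(1) primes_dvd_imp_eq two_is_prime_nat by blast
    \<comment> \<open>Parity is the only hypothesis for removing \<open>p\<close> that can fail, as
      \<open>m\<close> is not in T.\<close>
    have "\<not> (even m \<longrightarrow> even (lucas_v P Q m))"
      using T_set_div_largest_prime[of m p P Q] basic[OF p(1) m] n m largest p(1) odd by auto
    then have m2: "even m" and v_odd: "odd (lucas_v P Q m)" by auto
    then have "odd P" using even_lucas_v by blast
    have "even (int n)" using m m2 by simp
    moreover have "int n dvd lucas_v P Q n" using n by (simp add: T_set_def)
    ultimately have "even (lucas_v P Q n)" by (rule dvd_trans)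
    then have "odd Q" using odd_lucas_v[OF \<open>odd P\<close>] n1 by fastforce
    \<comment> \<open>Since \<open>v_n\<close> is even and \<open>v_m\<close> odd, passing from
      \<open>m\<close> to \<open>n = m * p\<close> must introduce the factor 3.\<close>
    have "3 dvd n" "\<not> 3 dvd m"
      using even_lucas_v_iff[OF \<open>odd P\<close> \<open>odd Q\<close>] v_odd \<open>even (lucas_v P Q n)\<close> by auto
    then have "3 dvd p"
      using m prime_dvd_mult_nat[of 3 m p] by auto
    then have "p = 3"
      using primes_dvd_imp_eq[of 3 p] p(1) by simp
    obtain k where k: "m = 2 * k" using m2 by (elim evenE)
    have "k = 1"
    proof (rule ccontr)
      assume "k \<noteq> 1"
      then obtain q where q: "prime q" "q dvd k" using prime_factor_nat by blast
      then have "q dvd n" unfolding m k by simp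
      then have "q \<le> 3" using largest[OF q(1)] \<open>p = 3\<close> by simp
      moreover have "q \<noteq> 3" using q(2) \<open>\<not> 3 dvd m\<close> k by auto
      ultimately have "q = 2" using prime_ge_2_nat[OF q(1)] by simp
      then have "2 * 2 dvd m" unfolding k using q(2) by (intro mult_dvd_mono) auto
      then have "4 dvd n" unfolding m by simp
      then show False using T_set_not_4_dvd[OF n \<open>odd Q\<close>] by simp
    qed
    then show False using not m k \<open>p = 3\<close> by simp
  qed
qed

lemma basic_1: "basic P Q 1"
  by (auto simp: basic_def T_set_def)

text \<open>Only divisibility of \<open>v_6\<close>, \<open>v_3\<close>, \<open>v_2\<close> by 6, 3,
  2 matters. These moduli divide 6, so 36 residue pairs decide.\<close>

lemma basic_6_iff:
  "basic P Q 6 \<longleftrightarrow> ([P = 1] (mod 6) \<or> [P = -1] (mod 6)) \<and> [Q = -1] (mod 6)"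
proof -
  let ?v = "lucas_v (P mod 6) (Q mod 6)"
  have v: "d dvd lucas_v P Q n \<longleftrightarrow> d dvd ?v n" if "d dvd 6" for d n
  proof (rule cong_dvd_iff, rule lucas_v_cong)
    show "[P = P mod 6] (mod d)" "[Q = Q mod 6] (mod d)"
      using that by (simp_all add: cong_def mod_mod_cancel)
  qed
  have "prime p \<and> p dvd 6 \<longleftrightarrow> p = 2 \<or> p = 3" for p :: nat
  proof
    assume p: "prime p \<and> p dvd 6"
    then have "p dvd 2 * 3" by simp
    then have "p dvd 2 \<or> p dvd 3" using p prime_dvd_mult_nat by blast
    then show "p = 2 \<or> p = 3" using p by (auto dest: primes_dvd_imp_eq[rotated 2])
  qed auto
  then have "basic P Q 6 \<longleftrightarrow> 6 \<in> T_set P Q \<and> \<not> (\<exists>p. (p = 2 \<or> p = 3) \<and> 6 div p \<in> T_set P Q)"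
    by (simp only: basic_def conj_assoc[symmetric])
  also have "\<dots> \<longleftrightarrow> 6 \<in> T_set P Q \<and> 3 \<notin> T_set P Q \<and> 2 \<notin> T_set P Q"
    by (auto simp: conj_disj_distribR ex_disj_distrib)
  also have "\<dots> \<longleftrightarrow> 6 dvd ?v 6 \<and> \<not> 3 dvd ?v 3 \<and> \<not> 2 dvd ?v 2"
    by (simp add: T_set_def v)
  also have "\<dots> \<longleftrightarrow> (P mod 6 = 1 \<or> P mod 6 = 5) \<and> Q mod 6 = 5"
  proof -
    have "x mod 6 \<in> {0, 1, 2, 3, 4, 5}" for x :: int
      using pos_mod_bound[of 6 x] pos_mod_sign[of 6 x] by auto
    moreover have "6 dvd lucas_v x y 6 \<and> \<not> 3 dvd lucas_v x y 3 \<and> \<not> 2 dvd lucas_v x y 2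
        \<longleftrightarrow> (x = 1 \<or> x = 5) \<and> y = 5"
      if "x \<in> {0, 1, 2, 3, 4, 5}" "y \<in> {0, 1, 2, 3, 4, 5}" for x y
      using that by (elim insertE) (simp_all add: eval_nat_numeral)
    ultimately show ?thesis by blast
  qed
  finally show ?thesis by (simp add: cong_def)
qed

section \<open>Chains from basic elements\<close>

text \<open>A non-basic element loses some prime and stays in T; strong induction gives a chain for
  the quotient, and that prime is appended last.\<close>

lemma T_set_basic_chain:
  assumes "n \<in> T_set P Q"
  shows "\<exists>b ps. basic P Q b \<and> n = b * prod_list ps \<and>
    (\<forall>i < length ps. b * prod_list (take i ps) \<in> T_set P Q \<and>
       ps ! i \<in> T_primes P Q (b * prod_list (take i ps)))"
  using assms
proof (induction n rule: less_induct)
  case (less n)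
  show ?case
  proof (cases "basic P Q n")
    case True
    then show ?thesis by (intro exI[of _ n] exI[of _ "[]"]) simp
  next
    case False
    then obtain p where p: "prime p" "p dvd n" "n div p \<in> T_set P Q"
      using less.prems by (auto simp: basic_def)
    have "n > 0" using less.prems by (simp add: T_set_def)
    then have "n div p < n" using prime_gt_1_nat[OF p(1)] by simp
    then obtain b ps where b: "basic P Q b" "n div p = b * prod_list ps"
      and ps: "\<And>i. i < length ps \<Longrightarrow> b * prod_list (take i ps) \<in> T_set P Q \<and>
        ps ! i \<in> T_primes P Q (b * prod_list (take i ps))"
      using less.IH[OF _ p(3)] by blast
    have n: "n = b * prod_list ps * p"
      using p(2) b(2) by (metis dvd_div_mult_self)
    show ?thesis
    proof (intro exI conjI allI impI)
      show "n = b * prod_list (ps @ [p])" using n by simp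
      fix i assume "i < length (ps @ [p])"
      then consider "i < length ps" | "i = length ps" by fastforce
      then have "b * prod_list (take i (ps @ [p])) \<in> T_set P Q \<and>
          (ps @ [p]) ! i \<in> T_primes P Q (b * prod_list (take i (ps @ [p])))"
      proof cases
        case 1
        then show ?thesis using ps by (simp add: nth_append)
      next
        case 2
        then show ?thesis using p b(2) n less.prems by (simp add: T_primes_def)
      qed
      then show "b * prod_list (take i (ps @ [p])) \<in> T_set P Q"
        "(ps @ [p]) ! i \<in> T_primes P Q (b * prod_list (take i (ps @ [p])))" by auto
    qed (rule b(1))
  qed
qed

theorem theorem13:
  fixes P Q :: int
  shows
    "(\<forall>n \<in> T_set P Q.
        T_primes P Q n - {2} = {p. prime p \<and> odd p \<and> int p dvd lucas_v P Q n} \<and>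
        (2 \<in> T_primes P Q n \<longleftrightarrow>
           product_of_special_primes P Q n \<and> (even P \<or> (odd Q \<and> 3 dvd n)))) \<and>
     (\<forall>n \<in> T_set P Q. \<exists>b ps.
        basic P Q b \<and> n = b * prod_list ps \<and>
        (\<forall>i < length ps.
           b * prod_list (take i ps) \<in> T_set P Q \<and>
           ps ! i \<in> T_primes P Q (b * prod_list (take i ps)))) \<and>
     {n. basic P Q n} =
       (if ([P = 1] (mod 6) \<or> [P = -1] (mod 6)) \<and> [Q = -1] (mod 6) then {1, 6} else {1})"
proof (intro conjI ballI)
  fix n assume n: "n \<in> T_set P Q"
  have "p \<noteq> 2 \<longleftrightarrow> odd p" if "prime p" for p :: nat
    using primes_dvd_imp_eq[OF two_is_prime_nat that] by auto
  then show "T_primes P Q n - {2} = {p. prime p \<and> odd p \<and> int p dvd lucas_v P Q n}"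
    using T_set_odd_prime_mult[OF n] by (auto simp: T_primes_def)
  show "2 \<in> T_primes P Q n \<longleftrightarrow>
      product_of_special_primes P Q n \<and> (even P \<or> (odd Q \<and> 3 dvd n))"
    using T_set_double[OF n] by (simp add: T_primes_def)
next
  \<comment> \<open>As 1 is always basic, only the status of 6 remains to be decided.\<close>
  have "{n. basic P Q n} = {n \<in> {1, 6}. basic P Q n}"
    using basic_eq_1_or_6 by auto
  also have "\<dots> = (if basic P Q 6 then {1, 6} else {1})"
    using basic_1[of P Q] by auto
  finally show "{n. basic P Q n} =
      (if ([P = 1] (mod 6) \<or> [P = -1] (mod 6)) \<and> [Q = -1] (mod 6) then {1, 6} else {1})"
    unfolding basic_6_iff .
qed (rule T_set_basic_chain)

end
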